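(* Fix $n\in\mathbb N$ and $p,K\in[1,\infty)$. Let $(X,d_X)$ and $(Y,d_Y)$ be metric spaces. Then the following two assertions are equivalent. (1) For every symmetric stochastic $n$ by $n$ matrix $A$ we have $\gamma(A,d_X^p)\le K\,\gamma(A,d_Y^p)$. (2) For every $D\in(K,\infty)$ and every $x_1,\ldots,x_n\in X$ that are not all equal, there exist $m\in\mathbb N$ and a nonconstant mapping $f:\{x_1,\ldots,x_n\}\to \ell_p^m(Y)$ such that $$\sum_{i=1}^n\sum_{j=1}^n d_{\ell_p^m(Y)}(f(x_i),f(x_j))^p\ \ge\ \frac{\|f\|_{\mathrm{Lip}}^p}{D}\sum_{i=1}^n\sum_{j=1}^n d_X(x_i,x_j)^p .$$
   Context: All metric spaces are assumed to contain at least two points. An $n\times n$ real matrix $A=(a_{ij})$ is symmetric stochastic if it is symmetric, has nonnegative entries, and each of its rows sums to $1$. For $p\in[1,\infty)$ and a metric space $(X,d_X)$, $\gamma(A,d_X^p)$ denotes the infimum over those $\gamma\in(0,\infty]$ such that for every $x_1,\ldots,x_n\in X$, $$\frac1{n^2}\sum_{i=1}^n\sum_{j=1}^n d_X(x_i,x_j)^p\le \frac{\gamma}{n}\sum_{i=1}^n\sum_{j=1}^n a_{ij}d_X(x_i,x_j)^p$$ (the value $\gamma=\infty$ is always regarded as admissible, so $\gamma(A,d_X^p)=\infty$ if no finite $\gamma$ works; $K\cdot\infty=\infty$). For $m\in\mathbb N$, $\ell_p^m(Y)$ is the set $Y^m$ with the metric $d_{\ell_p^m(Y)}(x,y)=\big(\sum_{i=1}^m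 d_Y(x_i,y_i)^p\big)^{1/p}$. $\|f\|_{\mathrm{Lip}}$ is the (smallest) Lipschitz constant of $f$ with respect to $d_X$ on $\{x_1,\ldots,x_n\}$ and the metric on the target. *)

theory Defs
  imports "HOL-Analysis.Analysis"
begin

(* The size n of the matrices is CARD('n) for a finite index type 'n;
   an n-tuple of points is a function on 'n. *)

definition symmetric_stochastic :: "real ^ 'n ^ 'n \<Rightarrow> bool" where
  "symmetric_stochastic A \<longleftrightarrow>
     transpose A = A \<and> (\<forall>i j. 0 \<le> A $ i $ j) \<and> (\<forall>i. (\<Sum>j\<in>UNIV. A $ i $ j) = 1)"

(* The quantity gamma(A, d^p) for the metric space (X, d).  The value infinity is
   inserted separately because it is admissible even if the sum on the right
   vanishes, where the ennreal product of infinity and 0 would be 0. *)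
definition spectral_gap_const :: "real ^ 'n ^ 'n \<Rightarrow> real \<Rightarrow> 'a set \<Rightarrow> ('a \<Rightarrow> 'a \<Rightarrow> real) \<Rightarrow> ennreal" where
  "spectral_gap_const A p X d =
     Inf (insert \<infinity> {ennreal g | g. 0 < g \<and>
       (\<forall>x :: 'n \<Rightarrow> 'a. range x \<subseteq> X \<longrightarrow>
          1 / (real CARD('n))\<^sup>2 * (\<Sum>i\<in>UNIV. \<Sum>j\<in>UNIV. d (x i) (x j) powr p)
          \<le> g / real CARD('n) * (\<Sum>i\<in>UNIV. \<Sum>j\<in>UNIV. A $ i $ j * d (x i) (x j) powr p))})"

(* Points of Y^m are functions on {..<m} that are undefined elsewhere, so that
   equality of functions is equality of m-tuples. *)
definition lp_carrier :: "nat \<Rightarrow> 'a set \<Rightarrow> (nat \<Rightarrow> 'a) set" where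
  "lp_carrier m Y = {..<m} \<rightarrow>\<^sub>E Y"

definition lp_dist :: "real \<Rightarrow> nat \<Rightarrow> ('a \<Rightarrow> 'a \<Rightarrow> real) \<Rightarrow> (nat \<Rightarrow> 'a) \<Rightarrow> (nat \<Rightarrow> 'a) \<Rightarrow> real" where
  "lp_dist p m d x y = (\<Sum>i<m. d (x i) (y i) powr p) powr (1 / p)"

(* For finite S, the only case used, the set of Lipschitz constants is nonempty and
   the infimum is attained. *)
definition lip_const :: "'a set \<Rightarrow> ('a \<Rightarrow> 'a \<Rightarrow> real) \<Rightarrow> ('b \<Rightarrow> 'b \<Rightarrow> real) \<Rightarrow> ('a \<Rightarrow> 'b) \<Rightarrow> real" where
  "lip_const S d d' f = Inf {L. 0 \<le> L \<and> (\<forall>u\<in>S. \<forall>v\<in>S. d' (f u) (f v) \<le> L * d u v)}"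

end

(* (2) implies (1): apply the Y-inequality to each coordinate of f, sum, and compare with X through
   the Lipschitz bound from above and the hypothesis on f from below.
   (1) implies (2): consider the matrices (dY (g (x i)) (g (x j)) powr p), for g with values in Y.
   If no finite sum M of them satisfies M <= c * (sum of M) * (dX (x i) (x j) powr p) entrywise,
   where c = D / (sum of dX (x i) (x j) powr p), a separating hyperplane gives nonnegative
   weights W. Up to scaling and a diagonal, which does not interact with distances, W is a
   symmetric stochastic matrix, and it violates (1). *)
theory Submission
  imports Defs
begin

section \<open>Distances in \<open>lp_carrier\<close> and Lipschitz constants on finite sets\<close>

lemma lp_dist_powr:
  assumes "1 \<le> p"
  shows "lp_dist p m d x y powr p = (\<Sum>i<m. d (x i) (y i) powr p)"
  using assms by (simp add: lp_dist_def powr_powr sum_nonneg)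

lemma lp_dist_eq_0_imp_eq:
  assumes "1 \<le> p" "Metric_space Y d" "x \<in> lp_carrier m Y" "y \<in> lp_carrier m Y"
    and "lp_dist p m d x y = 0"
  shows "x = y"
proof -
  interpret Metric_space Y d by fact
  have "(\<Sum>i<m. d (x i) (y i) powr p) = 0"
    using lp_dist_powr[OF assms(1), of m d x y] assms(1,5) by simp
  then have "\<forall>i<m. d (x i) (y i) = 0"
    by (subst (asm) sum_nonneg_eq_0_iff) auto
  with assms(3,4) show ?thesis
    unfolding lp_carrier_def by (intro PiE_ext[of x "{..<m}" "\<lambda>_. Y"]) (auto simp: PiE_iff)
qed

text \<open>The bound \<open>L\<close> witnesses that the set of admissible constants is nonempty;
  the infimum of the empty set of reals would say nothing.\<close>

lemma lip_const_nonneg: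
  assumes "0 \<le> L" "\<And>u v. u \<in> S \<Longrightarrow> v \<in> S \<Longrightarrow> d' (f u) (f v) \<le> L * d u v"
  shows "0 \<le> lip_const S d d' f"
  unfolding lip_const_def using assms by (intro cInf_greatest) auto

lemma lip_const_le:
  assumes "0 \<le> L" "\<And>u v. u \<in> S \<Longrightarrow> v \<in> S \<Longrightarrow> d' (f u) (f v) \<le> L * d u v"
  shows "lip_const S d d' f \<le> L"
  unfolding lip_const_def using assms by (intro cInf_lower bdd_belowI[of _ 0]) auto

text \<open>The sum of all difference quotients dominates each of them, so it serves as a Lipschitz
  constant without taking a maximum.\<close>

lemma finite_Lipschitz:
  fixes d :: "'a \<Rightarrow> 'a \<Rightarrow> real" and d' :: "'b \<Rightarrow> 'b \<Rightarrow> real"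
  assumes "finite S" "Metric_space X d" "S \<subseteq> X"
    and d': "\<And>a. d' a a = 0" "\<And>a b. 0 \<le> d' a b"
  obtains L where "0 \<le> L" "\<And>u v. u \<in> S \<Longrightarrow> v \<in> S \<Longrightarrow> d' (f u) (f v) \<le> L * d u v"
proof -
  interpret Metric_space X d by fact
  define R where "R = (\<lambda>(u, v). d' (f u) (f v) / d u v)"
  have R: "0 \<le> R w" for w by (auto simp: R_def d' split: prod.split)
  have "d' (f u) (f v) \<le> sum R (S \<times> S) * d u v" if "u \<in> S" "v \<in> S" for u v
  proof (cases "u = v")
    case False
    with that assms(3) have "0 < d u v" by (simp add: subset_iff)
    moreover have "R (u, v) \<le> sum R (S \<times> S)"
      using that assms(1) R by (intro member_le_sum) auto
    ultimately show ?thesis by (simp add: R_def field_simps)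
  qed (use R that assms(3) in \<open>auto simp: d' subset_iff\<close>)
  with R show thesis by (intro that[of "sum R (S \<times> S)"]) (auto intro: sum_nonneg)
qed

text \<open>The infimum is attained: for distinct points, the difference quotient is a lower bound
  of the set of admissible constants, and finiteness of \<open>S\<close> makes that set
  nonempty.\<close>

lemma lip_const_bound:
  fixes d :: "'a \<Rightarrow> 'a \<Rightarrow> real" and d' :: "'b \<Rightarrow> 'b \<Rightarrow> real"
  assumes "finite S" "Metric_space X d" "S \<subseteq> X"
    and d': "\<And>a. d' a a = 0" "\<And>a b. 0 \<le> d' a b"
    and "u \<in> S" "v \<in> S"
  shows "d' (f u) (f v) \<le> lip_const S d d' f * d u v"
proof (cases "u = v")
  case False
  interpret Metric_space X d by fact
  have pos: "0 < d u v" using False assms by (simp add: subset_iff)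
  obtain L where L: "0 \<le> L" "\<And>u v. u \<in> S \<Longrightarrow> v \<in> S \<Longrightarrow> d' (f u) (f v) \<le> L * d u v"
    using finite_Lipschitz[OF assms(1,2,3), of d' f] d' by blast
  have "d' (f u) (f v) / d u v \<le> lip_const S d d' f"
    unfolding lip_const_def using L pos assms(6,7)
    by (intro cInf_greatest) (auto simp: field_simps)
  with pos show ?thesis by (simp add: field_simps)
next
  case True
  then show ?thesis using assms Metric_space.mdist_zero[OF assms(2)] by (auto simp: subset_iff)
qed

section \<open>Upper bounds for the spectral gap constant and their use\<close>

lemma spectral_gap_const_le:
  fixes A :: "real ^ 'n ^ 'n"
  assumes "0 < g"
    and "\<And>x :: 'n \<Rightarrow> 'a. range x \<subseteq> X \<Longrightarrow>
          1 / (real CARD('n))\<^sup>2 * (\<Sum>i\<in>UNIV. \<Sum>j\<in>UNIV. d (x i) (x j) powr p)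
          \<le> g / real CARD('n) * (\<Sum>i\<in>UNIV. \<Sum>j\<in>UNIV. A $ i $ j * d (x i) (x j) powr p)"
  shows "spectral_gap_const A p X d \<le> ennreal g"
  unfolding spectral_gap_const_def using assms by (intro Inf_lower) auto

text \<open>Some admissible \<open>h\<close> lies below \<open>g\<close>, and it can be enlarged to
  \<open>g\<close> because the right-hand sum is nonnegative. Assuming strict inequality avoids
  asking whether the infimum is attained.\<close>

lemma spectral_gap_const_lessD:
  fixes A :: "real ^ 'n ^ 'n" and x :: "'n::finite \<Rightarrow> 'a"
  assumes "symmetric_stochastic A" "spectral_gap_const A p X d < ennreal g" "range x \<subseteq> X"
  shows "1 / (real CARD('n))\<^sup>2 * (\<Sum>i\<in>UNIV. \<Sum>j\<in>UNIV. d (x i) (x j) powr p)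
          \<le> g / real CARD('n) * (\<Sum>i\<in>UNIV. \<Sum>j\<in>UNIV. A $ i $ j * d (x i) (x j) powr p)"
    (is "?l \<le> _ * ?r")
proof -
  obtain h where h: "ennreal h < ennreal g" "0 < h" "?l \<le> h / real CARD('n) * ?r"
    using assms(2,3) unfolding spectral_gap_const_def Inf_less_iff by auto
  have "0 \<le> ?r"
    using assms(1) by (intro sum_nonneg mult_nonneg_nonneg) (auto simp: symmetric_stochastic_def)
  moreover have "h / real CARD('n) \<le> g / real CARD('n)"
    using h(1,2) by (intro divide_right_mono) (auto simp: ennreal_less_iff)
  ultimately show ?thesis using h(3) by (meson mult_right_mono order_trans)
qed

section \<open>The separation argument\<close>

text \<open>Realises natural number weights on generators by repetitions in a list; each repetition
  later becomes a coordinate of the embedding.\<close>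

lemma sum_list_concat_replicate:
  fixes \<phi> :: "'g \<Rightarrow> real"
  assumes "distinct us"
  shows "sum_list (map \<phi> (concat (map (\<lambda>w. replicate (k w) (h w)) us)))
    = (\<Sum>w\<in>set us. real (k w) * \<phi> (h w))"
  using assms by (induction us) (auto simp: sum_list_replicate)

(* Separating the convex hull of the normalised generators from an open orthant. Since the
   orthant is open, a point in both sets can be replaced by one with rational weights. *)
lemma multiset_or_weights:
  fixes M :: "'g \<Rightarrow> 'k::finite \<Rightarrow> real" and T :: "'k \<Rightarrow> real"
  assumes M: "\<And>g k. 0 \<le> M g k" and T: "\<And>k. 0 \<le> T k"
    and MT: "\<And>g k. g \<in> G \<Longrightarrow> T k = 0 \<Longrightarrow> M g k = 0"
    and c: "0 < c" and ne: "g0 \<in> G" "0 < sum (M g0) UNIV"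
  obtains (multiset) gs where "set gs \<subseteq> G" "0 < (\<Sum>k\<in>UNIV. \<Sum>g\<leftarrow>gs. M g k)"
      "\<And>k. (\<Sum>g\<leftarrow>gs. M g k) \<le> c * (\<Sum>k\<in>UNIV. \<Sum>g\<leftarrow>gs. M g k) * T k"
    | (weights) W where "\<And>k. 0 \<le> W k" "\<And>g. g \<in> G \<Longrightarrow> sum (M g) UNIV \<le> (\<Sum>k\<in>UNIV. W k * M g k)"
      "(\<Sum>k\<in>UNIV. W k * T k) \<le> 1 / c"
proof -
  define S where "S g = sum (M g) UNIV" for g
  define G1 where "G1 = {g \<in> G. 0 < S g}"
  \<comment> \<open>Where \<open>T k\<close> is positive, \<open>V g $ k < c\<close> says that
    \<open>M g k < c * S g * T k\<close>. Where \<open>T k\<close> is 0, \<open>M g k\<close>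
    vanishes for \<open>g\<close> in \<open>G\<close>, and the value 0 keeps the coordinate
    harmless.\<close>
  define V :: "'g \<Rightarrow> real ^ 'k" where "V g = (\<chi> k. if T k = 0 then 0 else M g k / (T k * S g))" for g
  define H where "H = convex hull (V ` G1)"
  define Q where "Q = {v :: real ^ 'k. \<forall>k. v $ k < c}"
  show thesis
  proof (cases "H \<inter> Q = {}")
    case False
    then obtain v where v: "v \<in> H" "\<And>k. v $ k < c" by (auto simp: Q_def)
    then obtain U u where U: "finite U" "U \<subseteq> V ` G1" "\<And>w. w \<in> U \<Longrightarrow> 0 \<le> u w"
      "sum u U = 1" "(\<Sum>w\<in>U. u w *\<^sub>R w) = v"
      unfolding H_def convex_hull_explicit by blast
    define h where "h = inv_into G1 V"
    have h: "h w \<in> G1" "V (h w) = w" if "w \<in> U" for w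
      using that U(2) by (auto simp: h_def inv_into_into f_inv_into_f subset_iff)
    have hS: "0 < S (h w)" "h w \<in> G" if "w \<in> U" for w using h(1)[OF that] by (auto simp: G1_def)
    \<comment> \<open>Undoing the division by \<open>S\<close>: weighted by \<open>\<mu>\<close>,
      the generators have total mass \<open>sum u U\<close>, which is 1.\<close>
    define \<mu> where "\<mu> w = u w / S (h w)" for w
    have \<mu>: "0 \<le> \<mu> w" if "w \<in> U" for w using U(3) hS that by (simp add: \<mu>_def less_imp_le)
    have coord: "(\<Sum>w\<in>U. \<mu> w * M (h w) k) = T k * v $ k" for k
    proof -
      have "\<mu> w * M (h w) k = T k * (u w * w $ k)" if "w \<in> U" for w
      proof (cases "T k = 0")
        case True
        then show ?thesis using MT hS(2)[OF that] by simp
      next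
        case False
        have "w $ k = V (h w) $ k" using h(2)[OF that] by simp
        then show ?thesis using False hS(1)[OF that] by (simp add: V_def \<mu>_def)
      qed
      then have "(\<Sum>w\<in>U. \<mu> w * M (h w) k) = T k * (\<Sum>w\<in>U. u w * w $ k)"
        by (simp add: sum_distrib_left)
      also have "(\<Sum>w\<in>U. u w * w $ k) = v $ k" using U(5) by (auto simp: sum_component)
      finally show ?thesis .
    qed
    \<comment> \<open>\<open>B k\<close> bounds the error in entry \<open>k\<close> when each weight
      is rounded up by at most 1, and \<open>a k\<close> is the slack left by
      \<open>v $ k < c\<close>. Scaling the weights by a large \<open>N\<close> makes the slack
      absorb the error; the successor in \<open>N\<close> keeps the total positive.\<close>
    define B where "B k = (\<Sum>w\<in>U. M (h w) k)" for k
    define a where "a k = T k * (c - v $ k)" for k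
    have B0: "0 \<le> B k" and a0: "0 \<le> a k" for k
      using M T[of k] v(2)[of k] by (auto simp: B_def a_def intro!: sum_nonneg)
    obtain N0 :: nat where N0: "(\<Sum>k\<in>UNIV. B k / a k) \<le> real N0" using real_arch_simple by blast
    define N where "N = Suc N0"
    have NB: "B k \<le> real N * a k" for k
    proof (cases "T k = 0")
      case True
      then show ?thesis using MT hS(2) by (simp add: B_def a_def)
    next
      case False
      then have "0 < a k" using T[of k] v(2)[of k] by (auto simp: a_def less_le)
      moreover have "B k / a k \<le> (\<Sum>k\<in>UNIV. B k / a k)"
        using B0 a0 by (intro member_le_sum) auto
      ultimately have "B k / a k \<le> real N" using N0 by (simp add: N_def)
      with \<open>0 < a k\<close> show ?thesis by (simp add: pos_divide_le_eq)
    qed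
    \<comment> \<open>Rounding up, so that the total mass stays at least \<open>N\<close>.\<close>
    define n where "n w = nat \<lceil>real N * \<mu> w\<rceil>" for w
    have n: "real N * \<mu> w \<le> real (n w)" "real (n w) \<le> real N * \<mu> w + 1" if "w \<in> U" for w
    proof -
      have "0 \<le> real N * \<mu> w" using \<mu>[OF that] by simp
      then show "real N * \<mu> w \<le> real (n w)" "real (n w) \<le> real N * \<mu> w + 1"
        unfolding n_def by linarith+
    qed
    obtain us where us: "set us = U" "distinct us" using finite_distinct_list[OF U(1)] by blast
    define gs where "gs = concat (map (\<lambda>w. replicate (n w) (h w)) us)"
    define R where "R k = (\<Sum>g\<leftarrow>gs. M g k)" for k
    have R: "R k = (\<Sum>w\<in>U. real (n w) * M (h w) k)" for k
      unfolding R_def gs_def using sum_list_concat_replicate[OF us(2), of "\<lambda>g. M g k"] us(1) by simp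
    have "sum R UNIV = (\<Sum>w\<in>U. real (n w) * S (h w))"
      unfolding R by (subst sum.swap) (simp add: S_def sum_distrib_left)
    also have "\<dots> \<ge> (\<Sum>w\<in>U. real N * \<mu> w * S (h w))"
      using n(1) hS(1) by (intro sum_mono mult_right_mono) (auto simp: less_imp_le)
    also have "(\<Sum>w\<in>U. real N * \<mu> w * S (h w)) = (\<Sum>w\<in>U. real N * u w)"
      using hS(1) by (intro sum.cong) (auto simp: \<mu>_def less_le)
    also have "\<dots> = real N" using U(4) by (simp flip: sum_distrib_left)
    finally have tot: "real N \<le> sum R UNIV" .
    have "R k \<le> c * sum R UNIV * T k" for k
    proof -
      have "R k \<le> (\<Sum>w\<in>U. (real N * \<mu> w + 1) * M (h w) k)"
        unfolding R using n(2) M by (intro sum_mono mult_right_mono) auto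
      also have "\<dots> = real N * (\<Sum>w\<in>U. \<mu> w * M (h w) k) + B k"
        by (simp add: B_def algebra_simps sum.distrib sum_distrib_left)
      also have "\<dots> \<le> real N * (T k * v $ k) + real N * a k" using NB[of k] by (simp add: coord)
      also have "\<dots> = real N * (c * T k)" by (simp add: a_def algebra_simps)
      also have "\<dots> \<le> sum R UNIV * (c * T k)" using tot c T by (intro mult_right_mono) auto
      finally show ?thesis by (simp add: mult_ac)
    qed
    moreover have "set gs \<subseteq> G" using hS(2) us(1) by (auto simp: gs_def)
    moreover have "0 < sum R UNIV" using tot by (simp add: N_def)
    ultimately show thesis using multiset[of gs] unfolding R_def by blast
  next
    case True
    have "convex H" by (simp add: H_def convex_convex_hull)
    moreover have "convex Q"
    proof -
      have "Q = (\<Inter>k. {v. axis k 1 \<bullet> v < c})" by (auto simp: Q_def inner_axis')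
      then show ?thesis by (auto intro!: convex_INT convex_halfspace_lt)
    qed
    moreover have "g0 \<in> G1" using ne by (simp add: G1_def S_def)
    then have "H \<noteq> {}" by (auto simp: H_def)
    moreover have "(\<chi> k. c - 1) \<in> Q" by (simp add: Q_def)
    then have "Q \<noteq> {}" by blast
    ultimately obtain w b where w: "w \<noteq> 0" "\<And>v. v \<in> Q \<Longrightarrow> w \<bullet> v \<le> b" "\<And>v. v \<in> H \<Longrightarrow> b \<le> w \<bullet> v"
      using separating_hyperplane_sets[of Q H] True by (metis inf_commute)
    define s where "s = (\<Sum>k\<in>UNIV. w $ k)"
    have dot: "w \<bullet> v = (\<Sum>k\<in>UNIV. w $ k * v $ k)" for v by (simp add: inner_vec_def)
    have w0: "0 \<le> w $ k" for k
    \<comment> \<open>\<open>Q\<close> is unbounded in every negative coordinate direction, so a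
      negative \<open>w $ k\<close> would make the functional unbounded above on \<open>Q\<close>.
      The shift \<open>t\<close> is chosen to push its value to at least \<open>b + 1\<close>; the
      maximum with 0 keeps \<open>v\<close> in \<open>Q\<close>.\<close>
    proof (rule ccontr)
      assume neg: "\<not> 0 \<le> w $ k"
      define t where "t = max 0 ((b - (c - 1) * s + 1) / - (w $ k))"
      define v :: "real ^ 'k" where "v = (\<chi> l. (c - 1) - (if l = k then t else 0))"
      have "v \<in> Q" by (auto simp: Q_def v_def t_def)
      then have "w \<bullet> v \<le> b" by (rule w(2))
      moreover have "w \<bullet> v = (c - 1) * s - w $ k * t"
      proof -
        have "w \<bullet> v = (\<Sum>l\<in>UNIV. (c - 1) * w $ l - (if l = k then w $ k * t else 0))"
          unfolding dot v_def by (intro sum.cong) (auto simp: algebra_simps)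
        then show ?thesis by (simp add: sum_subtractf s_def sum_distrib_left)
      qed
      moreover have "- (w $ k) * t \<ge> b - (c - 1) * s + 1"
        using neg unfolding t_def by (auto simp: field_simps max_def)
      ultimately show False by simp
    qed
    have s: "0 < s"
    proof -
      obtain k where "w $ k \<noteq> 0" using w(1) by (auto simp: vec_eq_iff)
      with w0[of k] have "0 < w $ k" by simp
      then show ?thesis unfolding s_def by (intro sum_pos2[of _ k]) (auto simp: w0)
    qed
    \<comment> \<open>The corner with all coordinates equal to \<open>c\<close> lies in the closure
      of \<open>Q\<close>; it is approached along the diagonal.\<close>
    have b: "c * s \<le> b"
    proof (rule field_le_epsilon)
      fix e :: real assume "0 < e"
      then have "(\<chi> k. c - e / s) \<in> Q" using s by (simp add: Q_def)
      then have "w \<bullet> (\<chi> k. c - e / s) \<le> b" by (rule w(2))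
      moreover have "w \<bullet> (\<chi> k. c - e / s) = s * (c - e / s)"
        unfolding dot s_def sum_distrib_right by simp
      ultimately show "c * s \<le> b + e" using s by (simp add: algebra_simps)
    qed
    \<comment> \<open>Moves the factor \<open>1 / T k\<close> from \<open>V\<close> into the weights
      and rescales so that the separating bound \<open>c * s\<close> becomes 1.\<close>
    define W where "W k = (if T k = 0 then 0 else w $ k / (T k * (c * s)))" for k
    show thesis
    proof (rule weights)
      show "0 \<le> W k" for k using T[of k] w0 c s by (simp add: W_def)
      show "sum (M g) UNIV \<le> (\<Sum>k\<in>UNIV. W k * M g k)" if "g \<in> G" for g
      proof (cases "0 < S g")
        case True
        with that have "V g \<in> H" by (auto simp: H_def G1_def intro: hull_inc)
        then have "c * s \<le> w \<bullet> V g" using b w(3) by force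
        also have "w \<bullet> V g = (\<Sum>k\<in>UNIV. W k * M g k) * (c * s) / S g"
          unfolding dot sum_distrib_right sum_divide_distrib using c s
          by (intro sum.cong) (auto simp: V_def W_def)
        finally show ?thesis using True c s by (simp add: field_simps flip: S_def)
      next
        \<comment> \<open>Generators of total 0 are absent from \<open>G1\<close>, but for them the
          inequality only asks for a nonnegative right side.\<close>
        case False
        have "0 \<le> (\<Sum>k\<in>UNIV. W k * M g k)"
          using T w0 c s M by (intro sum_nonneg) (simp add: W_def)
        with False show ?thesis by (simp add: S_def)
      qed
      have "(\<Sum>k\<in>UNIV. W k * T k) \<le> (\<Sum>k\<in>UNIV. w $ k / (c * s))"
        using w0 c s by (intro sum_mono) (auto simp: W_def)
      also have "\<dots> = 1 / c" using s by (simp flip: sum_divide_distrib s_def)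
      finally show "(\<Sum>k\<in>UNIV. W k * T k) \<le> 1 / c" .
    qed
  qed
qed

section \<open>From tuples constant on the fibres of \<open>x\<close> to arbitrary tuples\<close>

text \<open>Depending on which of \<open>b\<close> and \<open>\<delta> * a\<close> is larger, one of
  the two terms on the right suffices. The factor of \<open>a powr p\<close> can be taken as close
  to 1 as desired, at the expense of the other one.\<close>

lemma powr_add_le:
  fixes a b :: real
  assumes "0 \<le> a" "0 \<le> b" "0 < \<delta>" "0 < p"
  shows "(a + b) powr p \<le> (1 + \<delta>) powr p * a powr p + (1 + 1 / \<delta>) powr p * b powr p"
proof (cases "b \<le> \<delta> * a")
  case True
  then have "(a + b) powr p \<le> ((1 + \<delta>) * a) powr p"
    using assms by (intro powr_mono2) (auto simp: algebra_simps)
  also have "\<dots> = (1 + \<delta>) powr p * a powr p" using assms by (simp add: powr_mult)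
  finally show ?thesis by (smt (verit) mult_nonneg_nonneg powr_ge_zero)
next
  case False
  then have "(a + b) powr p \<le> ((1 + 1 / \<delta>) * b) powr p"
    using assms by (intro powr_mono2) (auto simp: field_simps)
  also have "\<dots> = (1 + 1 / \<delta>) powr p * b powr p" using assms by (simp add: powr_mult)
  finally show ?thesis by (smt (verit) mult_nonneg_nonneg powr_ge_zero)
qed

(* An inequality for tuples that are constant on the fibres of x extends to all tuples, at the
   cost of a factor q > 1: move each index to a representative of its fibre, and put large
   weights on the pairs (i, r i), which the vanishing of t on the diagonal makes free. *)
lemma extend_weights_to_all_tuples:
  fixes x :: "'n::finite \<Rightarrow> 'a" and W :: "'n \<times> 'n \<Rightarrow> real" and t :: "'a \<Rightarrow> 'a \<Rightarrow> real"
  assumes p: "1 \<le> p" and Y: "Metric_space Y d" and q: "1 < q"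
    and W: "\<And>k. 0 \<le> W k" and t: "\<And>i. t (x i) (x i) = 0"
    and WM: "\<And>g. range g \<subseteq> Y \<Longrightarrow> (\<Sum>(i,j)\<in>UNIV. d (g (x i)) (g (x j)) powr p)
            \<le> (\<Sum>(i,j)\<in>UNIV. W (i,j) * d (g (x i)) (g (x j)) powr p)"
  obtains W' :: "'n \<times> 'n \<Rightarrow> real" where "\<And>k. 0 \<le> W' k"
    "\<And>y. range y \<subseteq> Y \<Longrightarrow> (\<Sum>(i,j)\<in>UNIV. d (y i) (y j) powr p)
            \<le> (\<Sum>(i,j)\<in>UNIV. W' (i,j) * d (y i) (y j) powr p)"
    "(\<Sum>(i,j)\<in>UNIV. W' (i,j) * t (x i) (x j)) = q * (\<Sum>(i,j)\<in>UNIV. W (i,j) * t (x i) (x j))"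
proof -
  interpret Metric_space Y d by fact
  define r where "r i = inv x (x i)" for i
  have xr: "x (r i) = x i" for i by (simp add: r_def f_inv_into_f)
  \<comment> \<open>Chosen so that the main term in \<open>powr_add_le\<close> gets exactly the
    factor \<open>q\<close>.\<close>
  define \<delta> where "\<delta> = q powr (1 / p) - 1"
  have \<delta>: "0 < \<delta>" "(1 + \<delta>) powr p = q" using q p by (auto simp: \<delta>_def powr_powr)
  define C where "C = (1 + 1 / \<delta>) powr p * 2 powr p"
  have C: "0 \<le> C" by (simp add: C_def)
  \<comment> \<open>The image of \<open>W\<close> under moving both indices to their
    representatives.\<close>
  define W1 where "W1 = (\<lambda>(k,l). \<Sum>(i,j)\<in>UNIV. if r i = k \<and> r j = l then W (i,j) else 0)"
  define N where "N = real CARD('n)"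
  \<comment> \<open>When the pointwise estimate \<open>pt\<close> below is summed over all pairs,
    each displacement term \<open>e i powr p\<close> occurs \<open>2 * N\<close> times with factor
    \<open>C\<close>; the extra weight on \<open>(i, r i)\<close> pays for exactly this.\<close>
  define W' where "W' = (\<lambda>(k,l). q * W1 (k,l) + (if l = r k then 2 * N * C else 0))"
  have W1_sum: "(\<Sum>(k,l)\<in>UNIV. W1 (k,l) * E k l) = (\<Sum>(i,j)\<in>UNIV. W (i,j) * E (r i) (r j))"
    for E :: "'n \<Rightarrow> 'n \<Rightarrow> real"
  proof -
    have "(\<Sum>(k,l)\<in>UNIV. W1 (k,l) * E k l)
      = (\<Sum>kl\<in>UNIV. \<Sum>ij\<in>UNIV. if kl = (r (fst ij), r (snd ij)) then W ij * E (fst kl) (snd kl) else 0)"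
      by (auto simp: W1_def sum_distrib_right split_beta intro!: sum.cong)
    also have "\<dots> = (\<Sum>(i,j)\<in>UNIV. W (i,j) * E (r i) (r j))"
      by (subst sum.swap) (simp add: split_beta)
    finally show ?thesis .
  qed
  have diag_sum: "(\<Sum>(k,l)\<in>UNIV. (if l = r k then 2 * N * C else 0) * E k l) = 2 * N * C * (\<Sum>k\<in>UNIV. E k (r k))"
    for E :: "'n \<Rightarrow> 'n \<Rightarrow> real"
    unfolding UNIV_Times_UNIV[symmetric] sum.cartesian_product[symmetric]
    by (simp add: if_distrib[of "\<lambda>z. z * _"] sum_distrib_left cong: if_cong)
  have W'_sum: "(\<Sum>(k,l)\<in>UNIV. W' (k,l) * E k l)
      = q * (\<Sum>(i,j)\<in>UNIV. W (i,j) * E (r i) (r j)) + 2 * N * C * (\<Sum>k\<in>UNIV. E k (r k))"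
    for E :: "'n \<Rightarrow> 'n \<Rightarrow> real"
  proof -
    have "(\<Sum>(k,l)\<in>UNIV. W' (k,l) * E k l) = (\<Sum>(k,l)\<in>UNIV. q * (W1 (k,l) * E k l))
       + (\<Sum>(k,l)\<in>UNIV. (if l = r k then 2 * N * C else 0) * E k l)"
      unfolding sum.distrib[symmetric] by (rule sum.cong) (auto simp: W'_def algebra_simps)
    also have "(\<Sum>(k,l)\<in>UNIV. q * (W1 (k,l) * E k l)) = q * (\<Sum>(k,l)\<in>UNIV. W1 (k,l) * E k l)"
      by (simp add: sum_distrib_left split_beta)
    finally show ?thesis by (simp add: W1_sum diag_sum)
  qed
  show thesis
  proof (rule that[of W'])
    show "0 \<le> W' k" for k
    proof -
      have "0 \<le> W1 k" for k using W by (auto simp: W1_def split: prod.split intro!: sum_nonneg)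
      then show ?thesis using q C by (auto simp: W'_def N_def split: prod.split)
    qed
    \<comment> \<open>The extra weights contribute nothing here, since \<open>x (r k) = x k\<close>
      and \<open>t\<close> vanishes on equal points.\<close>
    show "(\<Sum>(i,j)\<in>UNIV. W' (i,j) * t (x i) (x j)) = q * (\<Sum>(i,j)\<in>UNIV. W (i,j) * t (x i) (x j))"
      by (simp add: W'_sum xr t)
    fix y :: "'n \<Rightarrow> 'b" assume y: "range y \<subseteq> Y"
    then have yY: "y i \<in> Y" for i by auto
    define e where "e i = d (y i) (y (r i))" for i
    have e: "0 \<le> e i" for i by (simp add: e_def)
    have pt: "d (y i) (y j) powr p \<le> q * d (y (r i)) (y (r j)) powr p + C * (e i powr p + e j powr p)"
      for i j
    proof -
      have "d (y i) (y j) \<le> e i + d (y (r i)) (y j)" unfolding e_def by (intro triangle yY)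
      also have "d (y (r i)) (y j) \<le> d (y (r i)) (y (r j)) + e j"
        unfolding e_def using triangle[of "y (r i)" "y (r j)" "y j"] yY by (simp add: commute)
      finally have "d (y i) (y j) powr p \<le> (d (y (r i)) (y (r j)) + (e i + e j)) powr p"
        using p by (intro powr_mono2) auto
      also have "\<dots> \<le> q * d (y (r i)) (y (r j)) powr p + (1 + 1 / \<delta>) powr p * (e i + e j) powr p"
        using powr_add_le[of "d (y (r i)) (y (r j))" "e i + e j" \<delta> p] p \<delta> e by simp
      also have "(e i + e j) powr p \<le> 2 powr p * (e i powr p + e j powr p)"
        using powr_add_le[of "e i" "e j" 1 p] p e by (simp add: algebra_simps)
      finally show ?thesis by (simp add: C_def mult_left_mono mult.assoc)
    qed
    have "(\<Sum>(i,j)\<in>UNIV. d (y i) (y j) powr p)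
       \<le> (\<Sum>(i,j)\<in>UNIV. q * d (y (r i)) (y (r j)) powr p + C * (e i powr p + e j powr p))"
      using pt by (intro sum_mono) auto
    also have "\<dots> = q * (\<Sum>(i,j)\<in>UNIV. d (y (r i)) (y (r j)) powr p)
         + C * (\<Sum>(i,j)\<in>UNIV. e i powr p + e j powr p)"
      by (simp add: split_beta sum.distrib sum_distrib_left distrib_left)
    also have "(\<Sum>(i,j)\<in>UNIV. e i powr p + e j powr p) = 2 * N * (\<Sum>i\<in>UNIV. e i powr p)"
      unfolding UNIV_Times_UNIV[symmetric] sum.cartesian_product[symmetric]
      by (simp add: sum.distrib N_def flip: sum_distrib_left)
    \<comment> \<open>The tuple \<open>y\<close> composed with \<open>r\<close> factors through
      \<open>x\<close>, so the hypothesis applies to \<open>y\<close> composed with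
      \<open>inv x\<close>.\<close>
    also have "q * (\<Sum>(i,j)\<in>UNIV. d (y (r i)) (y (r j)) powr p)
       \<le> q * (\<Sum>(i,j)\<in>UNIV. W (i,j) * d (y (r i)) (y (r j)) powr p)"
      using WM[of "\<lambda>u. y (inv x u)"] y q by (intro mult_left_mono) (auto simp: r_def)
    finally show "(\<Sum>(i,j)\<in>UNIV. d (y i) (y j) powr p)
            \<le> (\<Sum>(i,j)\<in>UNIV. W' (i,j) * d (y i) (y j) powr p)"
      by (simp add: W'_sum e_def mult_ac)
  qed
qed

section \<open>Stochastic matrices from nonnegative weights\<close>

text \<open>Symmetrise \<open>W\<close>, divide by a number so large that the off-diagonal row sums
  are at most 1, and put the missing mass on the diagonal, where \<open>E\<close> vanishes. Symmetry
  of \<open>E\<close> makes the symmetrisation invisible in the sum.\<close>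

lemma symmetric_stochastic_of_weights:
  fixes W :: "'n \<times> 'n::finite \<Rightarrow> real"
  assumes W: "\<And>k. 0 \<le> W k"
  obtains A :: "real ^ 'n ^ 'n" and s where "symmetric_stochastic A" "0 < s"
    "\<And>E. (\<And>i. E i i = 0) \<Longrightarrow> (\<And>i j. E i j = E j i) \<Longrightarrow>
       s * (\<Sum>i\<in>UNIV. \<Sum>j\<in>UNIV. A $ i $ j * E i j) = (\<Sum>(i,j)\<in>UNIV. W (i,j) * E i j)"
proof -
  \<comment> \<open>Row sums of the symmetrised weights are at most \<open>2 * sum W UNIV\<close>;
    the summand 1 keeps \<open>s\<close> positive when \<open>W\<close> is zero.\<close>
  define s where "s = 1 + 2 * sum W UNIV"
  have s: "0 < s" using W by (simp add: s_def sum_nonneg add_pos_nonneg)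
  define B where "B i j = (W (i,j) + W (j,i)) / (2 * s)" for i j
  have B: "0 \<le> B i j" "B i j = B j i" for i j using W s by (auto simp: B_def add.commute)
  define A :: "real ^ 'n ^ 'n" where
    "A = (\<chi> i j. if i = j then 1 - (\<Sum>l\<in>UNIV - {i}. B i l) else B i j)"
  have "(\<Sum>l\<in>UNIV - {i}. B i l) \<le> 1" for i
  proof -
    have 1: "(\<Sum>l\<in>UNIV. W (i,l)) = sum W (Pair i ` UNIV)"
      by (subst sum.reindex) (auto simp: inj_on_def)
    have 2: "(\<Sum>l\<in>UNIV. W (l,i)) = sum W ((\<lambda>l. (l,i)) ` UNIV)"
      by (subst sum.reindex) (auto simp: inj_on_def)
    have "(\<Sum>l\<in>UNIV - {i}. B i l) \<le> (\<Sum>l\<in>UNIV. B i l)"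
      using B by (intro sum_mono2) auto
    also have "\<dots> = ((\<Sum>l\<in>UNIV. W (i,l)) + (\<Sum>l\<in>UNIV. W (l,i))) / (2 * s)"
      by (simp add: B_def sum.distrib flip: sum_divide_distrib)
    also have "\<dots> \<le> (sum W UNIV + sum W UNIV) / (2 * s)"
      unfolding 1 2 using W s by (intro divide_right_mono add_mono sum_mono2) auto
    also have "\<dots> \<le> 1" using s by (simp add: s_def field_simps)
    finally show ?thesis .
  qed
  then have A0: "0 \<le> A $ i $ j" for i j using B(1) by (simp add: A_def)
  have "(\<Sum>j\<in>UNIV. A $ i $ j) = 1" for i
  proof -
    have "(\<Sum>j\<in>UNIV. A $ i $ j) = A $ i $ i + (\<Sum>j\<in>UNIV - {i}. A $ i $ j)"
      by (rule sum.remove) auto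
    also have "(\<Sum>j\<in>UNIV - {i}. A $ i $ j) = (\<Sum>j\<in>UNIV - {i}. B i j)"
      by (rule sum.cong) (auto simp: A_def)
    finally show ?thesis by (simp add: A_def)
  qed
  moreover have "transpose A = A" using B(2) by (auto simp: transpose_def A_def vec_eq_iff)
  ultimately have "symmetric_stochastic A" using A0 by (simp add: symmetric_stochastic_def)
  moreover have "s * (\<Sum>i\<in>UNIV. \<Sum>j\<in>UNIV. A $ i $ j * E i j) = (\<Sum>(i,j)\<in>UNIV. W (i,j) * E i j)"
    if E: "\<And>i. E i i = 0" "\<And>i j. E i j = E j i" for E :: "'n \<Rightarrow> 'n \<Rightarrow> real"
  proof -
    have AB: "A $ i $ j * E i j = B i j * E i j" for i j by (cases "i = j") (simp_all add: A_def E(1))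
    have "s * (\<Sum>i\<in>UNIV. \<Sum>j\<in>UNIV. A $ i $ j * E i j)
       = (\<Sum>i\<in>UNIV. \<Sum>j\<in>UNIV. (W (i,j) * E i j + W (j,i) * E i j) / 2)"
      unfolding AB sum_distrib_left using s by (intro sum.cong refl) (simp add: B_def field_simps)
    also have "\<dots> = ((\<Sum>i\<in>UNIV. \<Sum>j\<in>UNIV. W (i,j) * E i j) + (\<Sum>i\<in>UNIV. \<Sum>j\<in>UNIV. W (j,i) * E i j)) / 2"
      by (simp add: sum.distrib flip: sum_divide_distrib)
    also have "(\<Sum>i\<in>UNIV. \<Sum>j\<in>UNIV. W (j,i) * E i j) = (\<Sum>i\<in>UNIV. \<Sum>j\<in>UNIV. W (i,j) * E i j)"
      by (subst sum.swap) (simp add: E(2))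
    finally show ?thesis by (simp add: sum.cartesian_product)
  qed
  ultimately show thesis using that s by blast
qed

section \<open>From (1) to (2)\<close>

lemma gap_comparison_imp_lp_embedding:
  fixes x :: "'n::finite \<Rightarrow> 'a"
  assumes p: "1 \<le> p" and K: "1 \<le> K" and D: "K < D"
    and X: "Metric_space X dX"
    and Y: "Metric_space Y dY" "\<exists>a\<in>Y. \<exists>b\<in>Y. a \<noteq> b"
    and gap: "\<And>A :: real ^ 'n ^ 'n. symmetric_stochastic A \<Longrightarrow>
            spectral_gap_const A p X dX \<le> ennreal K * spectral_gap_const A p Y dY"
    and x: "range x \<subseteq> X" "x i0 \<noteq> x j0"
  shows "\<exists>m \<ge> 1. \<exists>f :: 'a \<Rightarrow> nat \<Rightarrow> 'b.
               f \<in> range x \<rightarrow> lp_carrier m Y \<and>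
               (\<exists>u \<in> range x. \<exists>v \<in> range x. f u \<noteq> f v) \<and>
               (\<Sum>i\<in>UNIV. \<Sum>j\<in>UNIV. lp_dist p m dY (f (x i)) (f (x j)) powr p)
               \<ge> lip_const (range x) dX (lp_dist p m dY) f powr p / D
                   * (\<Sum>i\<in>UNIV. \<Sum>j\<in>UNIV. dX (x i) (x j) powr p)"
proof -
  interpret X: Metric_space X dX by fact
  interpret Y: Metric_space Y dY by fact
  have xX: "x i \<in> X" for i using x by auto
  define T where "T = (\<lambda>(i,j). dX (x i) (x j) powr p)"
  define M where "M = (\<lambda>(g :: 'a \<Rightarrow> 'b) (i,j). dY (g (x i)) (g (x j)) powr p)"
  define G where "G = {g :: 'a \<Rightarrow> 'b. range g \<subseteq> Y}"
  have T0: "0 \<le> T k" for k by (auto simp: T_def split: prod.split)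
  have M0: "0 \<le> M g k" for g k by (auto simp: M_def split: prod.split)
  have "0 < T (i0, j0)" using x xX by (simp add: T_def)
  then have T: "0 < sum T UNIV" using T0 by (intro sum_pos2[of _ "(i0, j0)"]) auto
  obtain a b where ab: "a \<in> Y" "b \<in> Y" "a \<noteq> b" using Y(2) by blast
  \<comment> \<open>Separating \<open>x i0\<close> from \<open>x j0\<close> by two points of
    \<open>Y\<close> gives a generator with positive total.\<close>
  define g0 where "g0 u = (if u = x i0 then a else b)" for u
  have g0: "g0 \<in> G" using ab by (auto simp: G_def g0_def)
  have "0 < M g0 (i0, j0)" using x ab by (simp add: M_def g0_def)
  then have Mg0: "0 < sum (M g0) UNIV" using M0 by (intro sum_pos2[of _ "(i0, j0)"]) auto
  \<comment> \<open>With this \<open>c\<close>, the bound \<open>c * tot\<close> on the p-th power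
    of the Lipschitz constant gives exactly (2), as
    \<open>c * tot / D * sum T UNIV = tot\<close>.\<close>
  define c where "c = D / sum T UNIV"
  have c: "0 < c" using D K T by (simp add: c_def)
  have MT: "M g k = 0" if "g \<in> G" "T k = 0" for g k
  proof -
    obtain i j where k: "k = (i, j)" by (cases k)
    with that(2) xX have "x i = x j" by (simp add: T_def)
    moreover have "g (x j) \<in> Y" using that(1) by (auto simp: G_def)
    ultimately show ?thesis by (simp add: M_def k)
  qed
  show ?thesis
  proof (rule multiset_or_weights[of M T G c g0, OF M0 T0 MT c g0 Mg0])
    fix gs assume gs: "set gs \<subseteq> G" "0 < (\<Sum>k\<in>UNIV. \<Sum>g\<leftarrow>gs. M g k)"
      "\<And>k. (\<Sum>g\<leftarrow>gs. M g k) \<le> c * (\<Sum>k\<in>UNIV. \<Sum>g\<leftarrow>gs. M g k) * T k"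
    \<comment> \<open>Each entry of the list is one coordinate of \<open>f\<close>, so p-th powers
      of distances between values of \<open>f\<close> are sums of the generators' matrices.\<close>
    define m where "m = length gs"
    define f where "f u = (\<lambda>t\<in>{..<m}. (gs ! t) u)" for u
    define tot where "tot = (\<Sum>k\<in>UNIV. \<Sum>g\<leftarrow>gs. M g k)"
    have fM: "lp_dist p m dY (f (x i)) (f (x j)) powr p = (\<Sum>g\<leftarrow>gs. M g (i, j))" for i j
      unfolding lp_dist_powr[OF p]
      by (simp add: f_def M_def m_def sum_list_sum_nth atLeast0LessThan)
    have sumf: "(\<Sum>i\<in>UNIV. \<Sum>j\<in>UNIV. lp_dist p m dY (f (x i)) (f (x j)) powr p) = tot"
      by (simp add: fM tot_def sum.cartesian_product split_beta)
    have car: "f \<in> range x \<rightarrow> lp_carrier m Y"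
    proof -
      have "(gs ! t) u \<in> Y" if "t < m" for t u
        using gs(1) nth_mem[of t gs] that unfolding G_def m_def by blast
      then show ?thesis by (auto simp: lp_carrier_def f_def)
    qed
    have m: "1 \<le> m" using gs(2) by (cases gs) (auto simp: m_def)
    have nonconst: "\<exists>u\<in>range x. \<exists>v\<in>range x. f u \<noteq> f v"
    proof (rule ccontr)
      assume "\<not> ?thesis"
      then have eq: "f (x i) = f (x j)" for i j by blast
      have "f (x i) t \<in> Y" if "t < m" for i t using car that by (auto simp: lp_carrier_def)
      then have "lp_dist p m dY (f (x i)) (f (x j)) powr p = 0" for i j
        unfolding lp_dist_powr[OF p] eq[of i j] by simp
      then show False using sumf gs(2) by (simp add: tot_def)
    qed
    define L where "L = (c * tot) powr (1 / p)"
    have ct: "0 \<le> c * tot" using c gs(2) by (simp add: tot_def)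
    have Lip: "lp_dist p m dY (f u) (f v) \<le> L * dX u v" if "u \<in> range x" "v \<in> range x" for u v
    proof -
      obtain i j where ij: "u = x i" "v = x j" using \<open>u \<in> _\<close> \<open>v \<in> _\<close> by blast
      have "lp_dist p m dY (f u) (f v) = (lp_dist p m dY (f u) (f v) powr p) powr (1 / p)"
        using p by (simp add: powr_powr lp_dist_def sum_nonneg)
      also have "\<dots> \<le> (c * tot * T (i, j)) powr (1 / p)"
        using gs(3)[of "(i, j)"] p unfolding ij fM tot_def
        by (intro powr_mono2 sum_list_nonneg) (auto simp: M0)
      also have "\<dots> = L * dX u v"
        using ct T0[of "(i, j)"] p by (simp add: powr_mult L_def T_def ij powr_powr)
      finally show ?thesis .
    qed
    have L0: "0 \<le> L" by (simp add: L_def)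
    have "lip_const (range x) dX (lp_dist p m dY) f powr p \<le> L powr p"
      using lip_const_le[of L "range x" "lp_dist p m dY" f dX] lip_const_nonneg[of L "range x" "lp_dist p m dY" f dX]
        L0 Lip p by (intro powr_mono2) auto
    also have "L powr p = c * tot" using ct p by (simp add: L_def powr_powr)
    finally have "lip_const (range x) dX (lp_dist p m dY) f powr p / D * sum T UNIV
        \<le> c * tot / D * sum T UNIV"
      using D K T by (intro mult_right_mono divide_right_mono) auto
    also have "\<dots> = tot" using D K T by (simp add: c_def)
    also have "sum T UNIV = (\<Sum>i\<in>UNIV. \<Sum>j\<in>UNIV. dX (x i) (x j) powr p)"
      by (simp add: T_def sum.cartesian_product)
    finally show ?thesis using m car nonconst sumf by blast
  next
    fix W assume W: "\<And>k. 0 \<le> W k" "\<And>g. g \<in> G \<Longrightarrow> sum (M g) UNIV \<le> (\<Sum>k\<in>UNIV. W k * M g k)"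
      "(\<Sum>k\<in>UNIV. W k * T k) \<le> 1 / c"
    \<comment> \<open>The gap between \<open>K\<close> and \<open>D\<close> is spent twice: passing
      to \<open>K1\<close> yields a strict bound on the constant of \<open>X\<close>, and the factor
      \<open>q\<close> pays for the extension to all tuples.\<close>
    define K1 where "K1 = (K + D) / 2"
    have K1: "K < K1" "K1 < D" using D by (auto simp: K1_def)
    define q where "q = (K1 + D) / (2 * K1)"
    have q: "1 < q" "q * K1 < D" using K K1 by (auto simp: q_def field_simps)
    obtain W' :: "'n \<times> 'n \<Rightarrow> real" where W': "\<And>k. 0 \<le> W' k"
      "\<And>y. range y \<subseteq> Y \<Longrightarrow> (\<Sum>(i,j)\<in>UNIV. dY (y i) (y j) powr p)
            \<le> (\<Sum>(i,j)\<in>UNIV. W' (i,j) * dY (y i) (y j) powr p)"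
      "(\<Sum>(i,j)\<in>UNIV. W' (i,j) * dX (x i) (x j) powr p)
          = q * (\<Sum>(i,j)\<in>UNIV. W (i,j) * dX (x i) (x j) powr p)"
    proof (rule extend_weights_to_all_tuples[of p Y dY q W "\<lambda>u v. dX u v powr p" x])
      show "dX (x i) (x i) powr p = 0" for i using xX by simp
      show "(\<Sum>(i,j)\<in>UNIV. dY (g (x i)) (g (x j)) powr p)
            \<le> (\<Sum>(i,j)\<in>UNIV. W (i,j) * dY (g (x i)) (g (x j)) powr p)" if "range g \<subseteq> Y" for g
        using W(2)[of g] that by (simp add: G_def M_def split_beta)
    qed (use p Y q W in auto)
    obtain A :: "real ^ 'n ^ 'n" and s where A: "symmetric_stochastic A" "0 < s"
      "\<And>E. (\<And>i. E i i = 0) \<Longrightarrow> (\<And>i j. E i j = E j i) \<Longrightarrow>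
       s * (\<Sum>i\<in>UNIV. \<Sum>j\<in>UNIV. A $ i $ j * E i j) = (\<Sum>(i,j)\<in>UNIV. W' (i,j) * E i j)"
      using symmetric_stochastic_of_weights[of W'] W'(1) by blast
    define N where "N = real CARD('n)"
    have N: "0 < N" by (simp add: N_def)
    \<comment> \<open>The inequality for \<open>W'\<close> bounds the full sum by \<open>s\<close>
      times the \<open>A\<close>-weighted one; the normalisations \<open>1 / N^2\<close> and
      \<open>1 / N\<close> turn \<open>s\<close> into \<open>s / N\<close>.\<close>
    have "spectral_gap_const A p Y dY \<le> ennreal (s / N)"
    proof (rule spectral_gap_const_le)
      fix y :: "'n \<Rightarrow> 'b" assume y: "range y \<subseteq> Y"
      then have yY: "y i \<in> Y" for i by auto
      have "(\<Sum>i\<in>UNIV. \<Sum>j\<in>UNIV. dY (y i) (y j) powr p)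
         \<le> s * (\<Sum>i\<in>UNIV. \<Sum>j\<in>UNIV. A $ i $ j * dY (y i) (y j) powr p)"
        using W'(2)[OF y] A(3)[of "\<lambda>i j. dY (y i) (y j) powr p"] yY Y.commute
        by (simp add: sum.cartesian_product)
      then show "1 / (real CARD('n))\<^sup>2 * (\<Sum>i\<in>UNIV. \<Sum>j\<in>UNIV. dY (y i) (y j) powr p)
        \<le> s / N / real CARD('n) * (\<Sum>i\<in>UNIV. \<Sum>j\<in>UNIV. A $ i $ j * dY (y i) (y j) powr p)"
        using N unfolding N_def[symmetric] by (simp add: field_simps power2_eq_square)
    qed (use A N in simp)
    then have "spectral_gap_const A p X dX \<le> ennreal K * ennreal (s / N)"
      using gap[OF A(1)] by (meson mult_left_mono order_trans zero_le)
    also have "\<dots> < ennreal (K1 * (s / N))"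
      using K K1 A(2) N by (auto simp flip: ennreal_mult simp: ennreal_less_iff divide_strict_right_mono)
    finally have "1 / N\<^sup>2 * (\<Sum>i\<in>UNIV. \<Sum>j\<in>UNIV. dX (x i) (x j) powr p)
      \<le> K1 * (s / N) / N * (\<Sum>i\<in>UNIV. \<Sum>j\<in>UNIV. A $ i $ j * dX (x i) (x j) powr p)"
      using spectral_gap_const_lessD[OF A(1) _ x(1)] unfolding N_def by blast
    then have "sum T UNIV \<le> K1 * (s * (\<Sum>i\<in>UNIV. \<Sum>j\<in>UNIV. A $ i $ j * dX (x i) (x j) powr p))"
      using N by (simp add: T_def sum.cartesian_product field_simps power2_eq_square)
    also have "s * (\<Sum>i\<in>UNIV. \<Sum>j\<in>UNIV. A $ i $ j * dX (x i) (x j) powr p)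
       = q * (\<Sum>k\<in>UNIV. W k * T k)"
      using A(3)[of "\<lambda>i j. dX (x i) (x j) powr p"] xX X.commute W'(3)
      by (simp add: T_def split_beta)
    \<comment> \<open>By the choice of \<open>c\<close>, this bounds \<open>sum T UNIV\<close> by
      \<open>q * K1 / D\<close> times itself, which is absurd since that factor is below 1 and the
      sum is positive.\<close>
    also have "K1 * (q * (\<Sum>k\<in>UNIV. W k * T k)) \<le> K1 * (q * (1 / c))"
      using W(3) K K1 q by (intro mult_left_mono) auto
    also have "\<dots> = q * K1 / D * sum T UNIV" by (simp add: c_def)
    also have "\<dots> < sum T UNIV" using q(2) T D K by (simp add: field_simps)
    finally show ?thesis by simp
  qed
qed

section \<open>From (2) to (1)\<close>

lemma lp_embedding_imp_gap_inequality:
  fixes x :: "'n::finite \<Rightarrow> 'a" and A :: "real ^ 'n ^ 'n"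
  assumes p: "1 \<le> p" and D: "0 < D" and g: "0 < g"
    and X: "Metric_space X dX" and Y: "Metric_space Y dY"
    and A: "symmetric_stochastic A" "spectral_gap_const A p Y dY < ennreal g"
    and x: "range x \<subseteq> X"
    and f: "f \<in> range x \<rightarrow> lp_carrier m Y" "\<exists>u \<in> range x. \<exists>v \<in> range x. f u \<noteq> f v"
      "(\<Sum>i\<in>UNIV. \<Sum>j\<in>UNIV. lp_dist p m dY (f (x i)) (f (x j)) powr p)
         \<ge> lip_const (range x) dX (lp_dist p m dY) f powr p / D
             * (\<Sum>i\<in>UNIV. \<Sum>j\<in>UNIV. dX (x i) (x j) powr p)"
  shows "1 / (real CARD('n))\<^sup>2 * (\<Sum>i\<in>UNIV. \<Sum>j\<in>UNIV. dX (x i) (x j) powr p)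
     \<le> D * g / real CARD('n) * (\<Sum>i\<in>UNIV. \<Sum>j\<in>UNIV. A $ i $ j * dX (x i) (x j) powr p)"
proof -
  interpret X: Metric_space X dX by fact
  interpret Y: Metric_space Y dY by fact
  define N where "N = real CARD('n)"
  have N: "0 < N" by (simp add: N_def)
  have A0: "0 \<le> A $ i $ j" for i j using A(1) by (simp add: symmetric_stochastic_def)
  define F where "F i j = lp_dist p m dY (f (x i)) (f (x j))" for i j
  \<comment> \<open>\<open>lip_const_bound\<close> wants a distance vanishing on every diagonal
    pair, while \<open>dY\<close> is only known to do so on \<open>Y\<close>. The modified distance
    agrees with \<open>lp_dist\<close> on the values of \<open>f\<close>.\<close>
  define d' where "d' a b = (if a = b then 0 else lp_dist p m dY a b)" for a b
  have fY: "f (x i) t \<in> Y" if "t < m" for i t using f(1) that by (auto simp: lp_carrier_def)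
  have d': "lp_dist p m dY (f u) (f v) = d' (f u) (f v)" if "u \<in> range x" "v \<in> range x" for u v
    using that fY by (auto simp: d'_def lp_dist_def)
  define L where "L = lip_const (range x) dX (lp_dist p m dY) f"
  have "L = lip_const (range x) dX d' f"
    unfolding L_def lip_const_def by (simp add: d')
  moreover have "d' (f u) (f v) \<le> lip_const (range x) dX d' f * dX u v" if "u \<in> range x" "v \<in> range x" for u v
    by (rule lip_const_bound[OF _ X x _ _ that]) (auto simp: d'_def lp_dist_def)
  ultimately have FL: "F i j \<le> L * dX (x i) (x j)" for i j
    by (simp add: F_def d')
  have F0: "0 \<le> F i j" for i j by (simp add: F_def lp_dist_def)
  \<comment> \<open>Nonconstancy of \<open>f\<close> makes \<open>L\<close> positive, so
    \<open>L powr p\<close> can be cancelled at the end.\<close>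
  obtain i j where "f (x i) \<noteq> f (x j)" using f(2) by blast
  then have "F i j \<noteq> 0"
    using lp_dist_eq_0_imp_eq[OF p Y, of "f (x i)" m "f (x j)"] f(1) by (auto simp: F_def)
  then have "0 < L * dX (x i) (x j)" using F0[of i j] FL[of i j] by linarith
  then have L: "0 < L" using X.nonneg[of "x i" "x j"] by (simp add: zero_less_mult_iff)
  have FLp: "F i j powr p \<le> L powr p * dX (x i) (x j) powr p" for i j
    using powr_mono2[OF _ F0 FL, of p i j] p L by (simp add: powr_mult)
  have FA: "1 / N\<^sup>2 * (\<Sum>i\<in>UNIV. \<Sum>j\<in>UNIV. F i j powr p)
     \<le> g / N * (\<Sum>i\<in>UNIV. \<Sum>j\<in>UNIV. A $ i $ j * F i j powr p)"
  proof -
    have sw: "(\<Sum>i\<in>UNIV. \<Sum>j\<in>UNIV. \<Sum>t<m. h i j t) = (\<Sum>t<m. \<Sum>i\<in>UNIV. \<Sum>j\<in>UNIV. h i j t)"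
      for h :: "'n \<Rightarrow> 'n \<Rightarrow> nat \<Rightarrow> real"
    proof -
      have "(\<Sum>i\<in>UNIV. \<Sum>j\<in>UNIV. \<Sum>t<m. h i j t) = (\<Sum>i\<in>UNIV. \<Sum>t<m. \<Sum>j\<in>UNIV. h i j t)"
        by (intro sum.cong refl sum.swap)
      also have "\<dots> = (\<Sum>t<m. \<Sum>i\<in>UNIV. \<Sum>j\<in>UNIV. h i j t)" by (rule sum.swap)
      finally show ?thesis .
    qed
    \<comment> \<open>The inequality for \<open>Y\<close>, applied to the tuple of
      \<open>t\<close>-th coordinates of the values of \<open>f\<close> and summed over
      \<open>t\<close>.\<close>
    have "(\<Sum>t<m. 1 / N\<^sup>2 * (\<Sum>i\<in>UNIV. \<Sum>j\<in>UNIV. dY (f (x i) t) (f (x j) t) powr p))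
      \<le> (\<Sum>t<m. g / N * (\<Sum>i\<in>UNIV. \<Sum>j\<in>UNIV. A $ i $ j * dY (f (x i) t) (f (x j) t) powr p))"
      unfolding N_def using fY
      by (intro sum_mono spectral_gap_const_lessD[OF A, of "\<lambda>i. f (x i) _"]) auto
    then show ?thesis
      unfolding F_def lp_dist_powr[OF p] sum_distrib_left[of "A $ _ $ _"] sw
      by (simp only: sum_distrib_left[symmetric])
  qed
  define SX where "SX = (\<Sum>i\<in>UNIV. \<Sum>j\<in>UNIV. dX (x i) (x j) powr p)"
  define SA where "SA = (\<Sum>i\<in>UNIV. \<Sum>j\<in>UNIV. A $ i $ j * dX (x i) (x j) powr p)"
  have Lp: "0 < L powr p" using L by simp
  have "(\<Sum>i\<in>UNIV. \<Sum>j\<in>UNIV. A $ i $ j * F i j powr p) \<le> L powr p * SA"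
    unfolding SA_def sum_distrib_left
    using mult_left_mono[OF FLp A0] by (intro sum_mono) (simp add: mult_ac)
  then have "g / N * (\<Sum>i\<in>UNIV. \<Sum>j\<in>UNIV. A $ i $ j * F i j powr p) \<le> g / N * (L powr p * SA)"
    using g N by (intro mult_left_mono) auto
  moreover have "1 / N\<^sup>2 * (L powr p / D * SX) \<le> 1 / N\<^sup>2 * (\<Sum>i\<in>UNIV. \<Sum>j\<in>UNIV. F i j powr p)"
    using f(3) unfolding F_def L_def SX_def by (intro mult_left_mono) auto
  ultimately have "1 / N\<^sup>2 * (L powr p / D * SX) \<le> g / N * (L powr p * SA)" using FA by linarith
  then have "(L powr p / D) * (1 / N\<^sup>2 * SX) \<le> (L powr p / D) * (D * g / N * SA)"
    using D by (simp add: mult_ac)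
  moreover have "0 < L powr p / D" using Lp D by simp
  ultimately have "1 / N\<^sup>2 * SX \<le> D * g / N * SA" by (rule mult_le_cancel_left_pos[THEN iffD1, rotated])
  then show ?thesis by (simp add: SX_def SA_def N_def)
qed

section \<open>The equivalence\<close>

theorem theorem1p3:
  fixes p K :: real
    and X :: "'a set" and dX :: "'a \<Rightarrow> 'a \<Rightarrow> real"
    and Y :: "'b set" and dY :: "'b \<Rightarrow> 'b \<Rightarrow> real"
  assumes p: "1 \<le> p" and K: "1 \<le> K"
    and X: "Metric_space X dX" "\<exists>a\<in>X. \<exists>b\<in>X. a \<noteq> b"
    and Y: "Metric_space Y dY" "\<exists>a\<in>Y. \<exists>b\<in>Y. a \<noteq> b"
  shows "(\<forall>A :: real ^ 'n ^ 'n. symmetric_stochastic A \<longrightarrow>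
            spectral_gap_const A p X dX \<le> ennreal K * spectral_gap_const A p Y dY)
     \<longleftrightarrow>
         (\<forall>D > K. \<forall>x :: 'n::finite \<Rightarrow> 'a. range x \<subseteq> X \<and> (\<exists>i j. x i \<noteq> x j) \<longrightarrow>
            (\<exists>m \<ge> 1. \<exists>f :: 'a \<Rightarrow> nat \<Rightarrow> 'b.
               f \<in> range x \<rightarrow> lp_carrier m Y \<and>
               (\<exists>u \<in> range x. \<exists>v \<in> range x. f u \<noteq> f v) \<and>
               (\<Sum>i\<in>UNIV. \<Sum>j\<in>UNIV. lp_dist p m dY (f (x i)) (f (x j)) powr p)
               \<ge> lip_const (range x) dX (lp_dist p m dY) f powr p / D
                   * (\<Sum>i\<in>UNIV. \<Sum>j\<in>UNIV. dX (x i) (x j) powr p)))"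
    (is "?gap \<longleftrightarrow> ?emb")
proof
  assume ?gap
  then have gap: "\<And>A :: real ^ 'n ^ 'n. symmetric_stochastic A \<Longrightarrow>
      spectral_gap_const A p X dX \<le> ennreal K * spectral_gap_const A p Y dY" by blast
  show ?emb
    by (intro allI impI, elim conjE exE)
      (rule gap_comparison_imp_lp_embedding[OF p K _ X(1) Y gap])
next
  assume emb: ?emb
  show ?gap
  proof (intro allI impI)
    fix A :: "real ^ 'n ^ 'n" assume A: "symmetric_stochastic A"
    show "spectral_gap_const A p X dX \<le> ennreal K * spectral_gap_const A p Y dY"
    proof (cases "spectral_gap_const A p Y dY" rule: ennreal_cases)
      case top
      then show ?thesis using K by (simp add: ennreal_mult_top)
    next
      case (real s)
      \<comment> \<open>One \<open>\<delta>\<close> serves twice: \<open>K + \<delta>\<close> is an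
        admissible \<open>D\<close> in (2), and \<open>s + \<delta>\<close> is positive and strictly
        above the constant of \<open>Y\<close>, as the lemma for this direction requires.\<close>
      have bound: "spectral_gap_const A p X dX \<le> ennreal ((K + \<delta>) * (s + \<delta>))" if \<delta>: "0 < \<delta>" for \<delta>
      proof (rule spectral_gap_const_le)
        show "0 < (K + \<delta>) * (s + \<delta>)" using K real \<delta> by simp
        fix x :: "'n \<Rightarrow> 'a" assume x: "range x \<subseteq> X"
        show "1 / (real CARD('n))\<^sup>2 * (\<Sum>i\<in>UNIV. \<Sum>j\<in>UNIV. dX (x i) (x j) powr p)
          \<le> (K + \<delta>) * (s + \<delta>) / real CARD('n) * (\<Sum>i\<in>UNIV. \<Sum>j\<in>UNIV. A $ i $ j * dX (x i) (x j) powr p)"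
        proof (cases "\<exists>i j. x i \<noteq> x j")
          case True
          have "spectral_gap_const A p Y dY < ennreal (s + \<delta>)"
            using real \<delta> by (simp add: ennreal_less_iff)
          moreover obtain m and f :: "'a \<Rightarrow> nat \<Rightarrow> 'b" where "f \<in> range x \<rightarrow> lp_carrier m Y"
            "\<exists>u \<in> range x. \<exists>v \<in> range x. f u \<noteq> f v"
            "(\<Sum>i\<in>UNIV. \<Sum>j\<in>UNIV. lp_dist p m dY (f (x i)) (f (x j)) powr p)
               \<ge> lip_const (range x) dX (lp_dist p m dY) f powr p / (K + \<delta>)
                   * (\<Sum>i\<in>UNIV. \<Sum>j\<in>UNIV. dX (x i) (x j) powr p)"
            using emb[rule_format, of "K + \<delta>" x] True x \<delta> by auto
          ultimately show ?thesis
            using lp_embedding_imp_gap_inequality[OF p _ _ X(1) Y(1) A _ x] K real \<delta> by simp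
        next
          \<comment> \<open>Assertion (2) says nothing about constant tuples, but for them both
            sides are 0.\<close>
          case False
          have "dX (x i) (x j) = 0" for i j
            using False x Metric_space.mdist_zero[OF X(1)] by (metis range_subsetD)
          then show ?thesis by simp
        qed
      qed
      have "((\<lambda>\<delta>. ennreal ((K + \<delta>) * (s + \<delta>))) \<longlongrightarrow> ennreal ((K + 0) * (s + 0))) (at_right 0)"
        by (intro tendsto_intros)
      moreover have "\<forall>\<^sub>F \<delta> in at_right 0. spectral_gap_const A p X dX \<le> ennreal ((K + \<delta>) * (s + \<delta>))"
        using bound by (auto simp: eventually_at_filter)
      ultimately have "spectral_gap_const A p X dX \<le> ennreal ((K + 0) * (s + 0))"
        by (intro tendsto_lowerbound) auto
      then show ?thesis using K real by (simp add: ennreal_mult)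
    qed
  qed
qed

end
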